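(* Let $\mathcal{A}$ be an edge independent graph generative model on $n$ nodes with overlap $\mathrm{Ov}(\mathcal{A})$. For $\bm{A}$ drawn from $\mathcal{A}$, let $\Delta(\bm{A})$ be the number of triangles in the graph with adjacency matrix $\bm{A}$. Then $$\mathbb{E}[\Delta(\bm{A})] \le \frac{n^3}{6}\cdot \mathrm{Ov}(\mathcal{A})^3 .$$
   Context: All graphs are undirected, unweighted, node-labeled, on the vertex set $[n]=\{1,\dots,n\}$, without self-loops; a graph is identified with its symmetric adjacency matrix in $\{0,1\}^{n\times n}$ (zero diagonal). A graph generative model is a probability distribution $\mathcal{A}$ over such adjacency matrices. Volume: $\mathrm{Vol}(\mathcal{A}) := \mathbb{E}_{\bm{A}\sim\mathcal{A}}\big[\sum_{i<j}\bm{A}_{ij}\big]$. Overlap: $\mathrm{Ov}(\mathcal{A}) := \dfrac{\mathbb{E}_{\bm{A},\bm{A}'\sim\mathcal{A}}\big[\sum_{i<j}\bm{A}_{ij}\bm{A}'_{ij}\big]}{\mathrm{Vol}(\mathcal{A})}$, where $\bm{A},\bm{A}'$ are two independent samples from $\mathcal{A}$ (defined when $\mathrm{Vol}(\mathcal{A})>0$, which is assumed). Edge independent model: a distribution $\mathcal{A}$ such that, for some symmetric $\bm{P}\in[0,1]^{n\times n}$ (with zero diagonal, since there are no self-loops), $\bm{A}_{ij}=\bm{A}_{ji}=1$ with probability $\bm{P}_{ij}$ and $\bm{A}_{ij}=\bm{A}_{ji}=0$ otherwise, and the entries $\bm{A}_{ij}$, $i<j$, are mutually independent. A triangle is an unordered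 set of three distinct, pairwise adjacent nodes. *)

theory Defs
  imports "HOL-Probability.Probability"
begin

text \<open>Nodes are the numbers from 1 to n. A matrix is a function of two indices; entries outside
  the index range are fixed to be 0, so that a graph corresponds to exactly one function.\<close>

definition adjacency_matrices :: "nat \<Rightarrow> (nat \<Rightarrow> nat \<Rightarrow> real) set" where
  "adjacency_matrices n = {M.
     (\<forall>i j. M i j \<in> {0, 1}) \<and>
     (\<forall>i j. M i j = M j i) \<and>
     (\<forall>i. M i i = 0) \<and>
     (\<forall>i j. i \<notin> {1..n} \<or> j \<notin> {1..n} \<longrightarrow> M i j = 0)}"

definition node_pairs :: "nat \<Rightarrow> (nat \<times> nat) set" where
  "node_pairs n = {(i, j). i \<in> {1..n} \<and> j \<in> {1..n} \<and> i < j}"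

text \<open>There are only finitely many adjacency matrices for each n, so every distribution over them
  is given by a probability mass function, and all expectations below are finite sums.\<close>

definition graph_model :: "nat \<Rightarrow> (nat \<Rightarrow> nat \<Rightarrow> real) pmf \<Rightarrow> bool" where
  "graph_model n A \<longleftrightarrow> set_pmf A \<subseteq> adjacency_matrices n"

definition Vol :: "nat \<Rightarrow> (nat \<Rightarrow> nat \<Rightarrow> real) pmf \<Rightarrow> real" where
  "Vol n A = measure_pmf.expectation A (\<lambda>M. \<Sum>(i, j)\<in>node_pairs n. M i j)"

definition Ov :: "nat \<Rightarrow> (nat \<Rightarrow> nat \<Rightarrow> real) pmf \<Rightarrow> real" where
  "Ov n A =
     measure_pmf.expectation (pair_pmf A A) (\<lambda>(M, M'). \<Sum>(i, j)\<in>node_pairs n. M i j * M' i j)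
       / Vol n A"

definition edge_independent :: "nat \<Rightarrow> (nat \<Rightarrow> nat \<Rightarrow> real) pmf \<Rightarrow> bool" where
  "edge_independent n A \<longleftrightarrow>
     graph_model n A \<and>
     (\<exists>P :: nat \<Rightarrow> nat \<Rightarrow> real.
        (\<forall>i\<in>{1..n}. \<forall>j\<in>{1..n}. 0 \<le> P i j \<and> P i j \<le> 1 \<and> P i j = P j i) \<and>
        (\<forall>i\<in>{1..n}. P i i = 0) \<and>
        (\<forall>(i, j)\<in>node_pairs n.
           measure_pmf.prob A {M. M i j = 1 \<and> M j i = 1} = P i j \<and>
           measure_pmf.prob A {M. M i j = 0 \<and> M j i = 0} = 1 - P i j)) \<and>
     prob_space.indep_vars (measure_pmf A) (\<lambda>_. borel) (\<lambda>(i, j) M. M i j) (node_pairs n)"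

definition triangles :: "nat \<Rightarrow> (nat \<Rightarrow> nat \<Rightarrow> real) \<Rightarrow> nat set set" where
  "triangles n M = {T. T \<subseteq> {1..n} \<and> card T = 3 \<and> (\<forall>u\<in>T. \<forall>v\<in>T. u \<noteq> v \<longrightarrow> M u v = 1)}"

end

theory Submission imports Defs begin

text \<open>Let P be the matrix of edge probabilities. By independence the expected number of triangles
  is tr(P^3)/6, and the overlap is F/W, where F is the squared Frobenius norm of P and W the sum of
  its entries. The Cauchy-Schwarz inequality, applied to the trace and then to the entries of P^2,
  gives tr(P^3)^2 \<le> F^3; applied to the entries of P it gives W^2 \<le> n^2 F. Together they
  yield tr(P^3)^2 W^6 \<le> (n F)^6.\<close>

text \<open>A 0/1 matrix is determined by the positions of its ones, and these lie in a finite
  square. Finiteness of the support later makes every real function integrable.\<close>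

lemma finite_adjacency_matrices: "finite (adjacency_matrices n)"
proof -
  let ?E = "\<lambda>M :: nat \<Rightarrow> nat \<Rightarrow> real. {(i, j). M i j = 1}"
  have "inj_on ?E (adjacency_matrices n)"
  proof (rule inj_onI, intro ext)
    fix M N :: "nat \<Rightarrow> nat \<Rightarrow> real" and i j
    assume M: "M \<in> adjacency_matrices n" and N: "N \<in> adjacency_matrices n" and eq: "?E M = ?E N"
    have "M i j \<in> {0, 1}" "N i j \<in> {0, 1}"
      using M N by (simp_all add: adjacency_matrices_def)
    moreover have "M i j = 1 \<longleftrightarrow> N i j = 1"
      using eq by blast
    ultimately show "M i j = N i j"
      by auto
  qed
  moreover have "?E ` adjacency_matrices n \<subseteq> Pow ({1..n} \<times> {1..n})"
  proof clarify
    fix M :: "nat \<Rightarrow> nat \<Rightarrow> real" and i j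
    assume M: "M \<in> adjacency_matrices n" and "M i j = 1"
    have "i \<notin> {1..n} \<or> j \<notin> {1..n} \<longrightarrow> M i j = 0"
      using M unfolding adjacency_matrices_def by blast
    with \<open>M i j = 1\<close> show "i \<in> {1..n} \<and> j \<in> {1..n}"
      by auto
  qed
  ultimately show ?thesis
    by (meson finite_Pow_iff finite_SigmaI finite_atLeastAtMost finite_imageD finite_subset)
qed

text \<open>The square splits into the strict upper triangle, its mirror image and the diagonal.
  This turns the sums in \<open>Vol\<close> and \<open>Ov\<close> into sums over the full square,
  the form used for Cauchy-Schwarz.\<close>

lemma sum_node_pairs:
  fixes f :: "nat \<Rightarrow> nat \<Rightarrow> real"
  assumes sym: "\<And>i j. f i j = f j i" and diag: "\<And>i. f i i = 0"
  shows "(\<Sum>(i, j)\<in>{1..n} \<times> {1..n}. f i j) = 2 * (\<Sum>(i, j)\<in>node_pairs n. f i j)"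
proof -
  let ?U = "node_pairs n" and ?L = "prod.swap ` node_pairs n" and ?D = "(\<lambda>i. (i, i)) ` {1..n}"
  have fin: "finite ?U"
    by (rule finite_subset[of _ "{1..n} \<times> {1..n}"]) (auto simp: node_pairs_def)
  have split: "{1..n} \<times> {1..n} = (?U \<union> ?L) \<union> ?D"
    by (auto simp: node_pairs_def image_iff)
  have "sum (case_prod f) ({1..n} \<times> {1..n})
      = sum (case_prod f) ?U + sum (case_prod f) ?L + sum (case_prod f) ?D"
    unfolding split using fin
    by (subst sum.union_disjoint, simp, simp, force simp: node_pairs_def,
        subst sum.union_disjoint) (auto simp: node_pairs_def)
  also have "sum (case_prod f) ?L = sum (case_prod f) ?U"
    by (subst sum.reindex) (auto simp: sym intro: sum.cong)
  also have "sum (case_prod f) ?D = 0"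
    by (rule sum.neutral) (auto simp: diag)
  finally show ?thesis
    by simp
qed

text \<open>Each triangle has 3! = 6 orderings, and a triple with a repeated index contributes
  nothing because the diagonal is zero.\<close>

lemma card_triangles:
  assumes M: "M \<in> adjacency_matrices n"
  shows "real (card (triangles n M))
    = (\<Sum>(i, j, k)\<in>{1..n} \<times> {1..n} \<times> {1..n}. M i j * M j k * M k i) / 6"
proof -
  let ?I = "{1..n} \<times> {1..n} \<times> {1..n}"
  let ?g = "\<lambda>(i, j, k). {i, j, k} :: nat set"
  define S where "S = {(i, j, k) \<in> ?I. M i j = 1 \<and> M j k = 1 \<and> M k i = 1}"
  have bin: "M i j = 0 \<or> M i j = 1" and sym: "M i j = M j i" and diag: "M i i = 0" for i j
    using M by (auto simp: adjacency_matrices_def)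
  have finT: "finite (triangles n M)"
    by (rule finite_subset[of _ "Pow {1..n}"]) (auto simp: triangles_def)
  have finS: "finite S"
    by (rule finite_subset[of _ ?I]) (auto simp: S_def)
  have fiber: "card {z \<in> S. ?g z = T} = 6" if T: "T \<in> triangles n M" for T
  proof -
    obtain a b c where abc: "T = {a, b, c}" "a \<noteq> b" "b \<noteq> c" "c \<noteq> a"
      using T by (auto simp: triangles_def card_3_iff)
    have "{z \<in> S. ?g z = T}
        = {(a, b, c), (a, c, b), (b, a, c), (b, c, a), (c, a, b), (c, b, a)}" (is "?L = ?R")
    proof
      show "?L \<subseteq> ?R"
      proof
        fix x assume "x \<in> ?L"
        then obtain i j k where x: "x = (i, j, k)" and z: "(i, j, k) \<in> S" and e: "{i, j, k} = T"
          by (cases x) auto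
        have "i \<noteq> j" "j \<noteq> k" "k \<noteq> i"
          using z diag by (auto simp: S_def)
        moreover have "i \<in> {a, b, c}" "j \<in> {a, b, c}" "k \<in> {a, b, c}"
          using e abc by auto
        ultimately show "x \<in> ?R"
          unfolding x by auto
      qed
      show "?R \<subseteq> ?L"
        using T abc by (auto simp: S_def triangles_def)
    qed
    also have "card \<dots> = 6"
      using abc by auto
    finally show ?thesis .
  qed
  have img: "?g ` S \<subseteq> triangles n M"
  proof clarify
    fix i j k assume z: "(i, j, k) \<in> S"
    then have "i \<noteq> j" "j \<noteq> k" "k \<noteq> i"
      using diag by (auto simp: S_def)
    with z show "{i, j, k} \<in> triangles n M"
      using sym by (auto simp: S_def triangles_def)
  qed
  \<comment> \<open>Double counting: ordered triples are grouped by their underlying vertex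
    set.\<close>
  have "real (card S) = (\<Sum>T\<in>triangles n M. real (card {z \<in> S. ?g z = T}))"
    using sum.group[OF finS finT img, of "\<lambda>_. 1 :: real"] by simp
  also have "\<dots> = 6 * real (card (triangles n M))"
    by (simp add: fiber)
  finally have "real (card S) = 6 * real (card (triangles n M))" .
  \<comment> \<open>As entries are 0 or 1, the product is the indicator of \<open>S\<close>.\<close>
  moreover have "(\<Sum>(i, j, k)\<in>?I. M i j * M j k * M k i) = (\<Sum>z\<in>?I. if z \<in> S then 1 else 0)"
    by (rule sum.cong) (use bin in \<open>auto simp: S_def\<close>, (metis mult_eq_0_iff mult_1)+)
  moreover have "(\<Sum>z\<in>?I. if z \<in> S then 1 else 0) = real (card S)"
    by (subst sum.inter_restrict[symmetric]) (auto simp: S_def intro!: arg_cong[where f = card])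
  ultimately show ?thesis
    by simp
qed

text \<open>For symmetric \<open>p\<close> the left-hand sum is the trace of the cube of
  \<open>p\<close>, that is, the Frobenius inner product of \<open>p\<close> with its
  square.\<close>

lemma trace_cube_le:
  fixes p :: "'a \<Rightarrow> 'a \<Rightarrow> real"
  assumes sym: "\<And>i j. p i j = p j i"
  shows "(\<Sum>(i, j, k)\<in>I \<times> I \<times> I. p i j * p j k * p k i)\<^sup>2 \<le> (\<Sum>(i, j)\<in>I \<times> I. (p i j)\<^sup>2) ^ 3"
proof -
  define F where "F = (\<Sum>(i, j)\<in>I \<times> I. (p i j)\<^sup>2)"
  have F_eq: "F = (\<Sum>i\<in>I. \<Sum>k\<in>I. (p i k)\<^sup>2)"
    unfolding F_def by (simp add: sum.cartesian_product)
  have F0: "F \<ge> 0"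
    unfolding F_def by (rule sum_nonneg) auto
  \<comment> \<open>By symmetry of \<open>p\<close>, the inner product of rows \<open>i\<close> and
    \<open>j\<close> is an entry of the matrix square.\<close>
  define q where "q = (\<lambda>(i, j). \<Sum>k\<in>I. p i k * p j k)"
  have "(\<Sum>(i, j, k)\<in>I \<times> I \<times> I. p i j * p j k * p k i)
      = (\<Sum>i\<in>I. \<Sum>j\<in>I. \<Sum>k\<in>I. p i j * (p i k * p j k))"
    by (simp add: sum.cartesian_product[symmetric] mult_ac sym)
  also have "\<dots> = (\<Sum>i\<in>I. \<Sum>j\<in>I. p i j * q (i, j))"
    by (simp add: q_def sum_distrib_left)
  also have "\<dots> = (\<Sum>z\<in>I \<times> I. case_prod p z * q z)"
    by (simp add: sum.cartesian_product case_prod_unfold)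
  also have "\<dots>\<^sup>2 \<le> (\<Sum>z\<in>I \<times> I. (case_prod p z)\<^sup>2) * (\<Sum>z\<in>I \<times> I. (q z)\<^sup>2)"
    by (rule Cauchy_Schwarz_ineq_sum)
  also have "\<dots> \<le> F * (F * F)"
  proof (rule mult_mono)
    \<comment> \<open>Cauchy-Schwarz on each pair of rows; the resulting double sum of squared row
      norms factors.\<close>
    have "(\<Sum>z\<in>I \<times> I. (q z)\<^sup>2) \<le> (\<Sum>(i, j)\<in>I \<times> I. (\<Sum>k\<in>I. (p i k)\<^sup>2) * (\<Sum>k\<in>I. (p j k)\<^sup>2))"
      by (rule sum_mono) (auto simp: q_def intro: Cauchy_Schwarz_ineq_sum)
    also have "\<dots> = F * F"
      unfolding F_eq by (subst sum_product) (rule sum.cartesian_product[symmetric])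
    finally show "(\<Sum>z\<in>I \<times> I. (q z)\<^sup>2) \<le> F * F" .
  qed (use F0 in \<open>auto simp: F_def case_prod_unfold intro: sum_nonneg\<close>)
  finally show ?thesis
    by (simp add: F_def power3_eq_cube mult_ac)
qed

text \<open>On finite supports both sides are finite sums, and the weights of
  \<open>pair_pmf\<close> are products. It is used for the two independent samples in
  \<open>Ov\<close>.\<close>

lemma expectation_pair_pmf_mult:
  fixes f :: "'a \<Rightarrow> real" and g :: "'b \<Rightarrow> real"
  assumes "finite (set_pmf A)" "finite (set_pmf B)"
  shows "measure_pmf.expectation (pair_pmf A B) (\<lambda>(x, y). f x * g y)
    = measure_pmf.expectation A f * measure_pmf.expectation B g"
proof -
  have "measure_pmf.expectation (pair_pmf A B) (\<lambda>(x, y). f x * g y)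
      = (\<Sum>z\<in>set_pmf A \<times> set_pmf B. pmf (pair_pmf A B) z * (case z of (x, y) \<Rightarrow> f x * g y))"
    by (subst integral_measure_pmf[of "set_pmf A \<times> set_pmf B"]) (use assms in \<open>auto\<close>)
  also have "\<dots> = (\<Sum>x\<in>set_pmf A. \<Sum>y\<in>set_pmf B. (pmf A x * f x) * (pmf B y * g y))"
    by (simp add: sum.cartesian_product case_prod_unfold pmf_pair mult_ac)
       (auto intro!: sum.cong simp: pmf_pair)
  also have "\<dots> = (\<Sum>x\<in>set_pmf A. pmf A x * f x) * (\<Sum>y\<in>set_pmf B. pmf B y * g y)"
    by (simp add: sum_product)
  also have "(\<Sum>x\<in>set_pmf A. pmf A x * f x) = measure_pmf.expectation A f"
    by (subst integral_measure_pmf[of "set_pmf A"]) (use assms in auto)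
  also have "(\<Sum>y\<in>set_pmf B. pmf B y * g y) = measure_pmf.expectation B g"
    by (subst integral_measure_pmf[of "set_pmf B"]) (use assms in auto)
  finally show ?thesis .
qed

text \<open>For an edge independent model this agrees on \<open>{1..n}\<close> with the matrix
  \<open>P\<close> of that definition, since entries are 0 or 1. Using the expectation avoids
  choosing a witness and gives a function on all indices.\<close>

definition edge_prob :: "(nat \<Rightarrow> nat \<Rightarrow> real) pmf \<Rightarrow> nat \<Rightarrow> nat \<Rightarrow> real" where
  "edge_prob A i j = measure_pmf.expectation A (\<lambda>M. M i j)"

context
  fixes n :: nat and A :: "(nat \<Rightarrow> nat \<Rightarrow> real) pmf"
  assumes model: "graph_model n A"
begin

lemma adjacency_matrix_if_mem: "M \<in> set_pmf A \<Longrightarrow> M \<in> adjacency_matrices n"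
  using model by (auto simp: graph_model_def)

lemma finite_set_pmf_graph_model: "finite (set_pmf A)"
  using model finite_adjacency_matrices finite_subset by (auto simp: graph_model_def)

lemma sym_if_mem: "M \<in> set_pmf A \<Longrightarrow> M i j = M j i"
  and diag_if_mem: "M \<in> set_pmf A \<Longrightarrow> M i i = 0"
  using adjacency_matrix_if_mem by (auto simp: adjacency_matrices_def)

lemma integrable_graph_model: "integrable (measure_pmf A) (f :: _ \<Rightarrow> real)"
  by (rule integrable_measure_pmf_finite[OF finite_set_pmf_graph_model])

text \<open>Symmetry of the samples is known only on the support, hence the almost-everywhere
  congruence.\<close>

lemma edge_prob_sym: "edge_prob A i j = edge_prob A j i"
  unfolding edge_prob_def by (intro integral_cong_AE) (auto simp: AE_measure_pmf_iff sym_if_mem)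

lemma edge_prob_diag: "edge_prob A i i = 0"
proof -
  have "edge_prob A i i = measure_pmf.expectation A (\<lambda>_. 0)"
    unfolding edge_prob_def by (intro integral_cong_AE) (auto simp: AE_measure_pmf_iff diag_if_mem)
  then show ?thesis by simp
qed

lemma Vol_eq: "2 * Vol n A = (\<Sum>(i, j)\<in>{1..n} \<times> {1..n}. edge_prob A i j)"
  using sum_node_pairs[of "edge_prob A" n, OF edge_prob_sym edge_prob_diag]
  by (simp add: Vol_def edge_prob_def case_prod_unfold integrable_graph_model)

text \<open>Independence of the two samples turns each expected product into a square. Passing to
  the full square doubles the numerator, which the factor 2 below compensates.\<close>

lemma Ov_eq: "Ov n A = (\<Sum>(i, j)\<in>{1..n} \<times> {1..n}. (edge_prob A i j)\<^sup>2) / (2 * Vol n A)"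
proof -
  have "measure_pmf.expectation (pair_pmf A A)
        (\<lambda>(M, M'). \<Sum>(i, j)\<in>node_pairs n. M i j * M' i j)
      = (\<Sum>z\<in>node_pairs n. measure_pmf.expectation (pair_pmf A A)
          (\<lambda>(M, M'). M (fst z) (snd z) * M' (fst z) (snd z)))"
    unfolding case_prod_unfold
    by (rule Bochner_Integration.integral_sum)
       (auto intro!: integrable_measure_pmf_finite simp: finite_set_pmf_graph_model)
  also have "\<dots> = (\<Sum>(i, j)\<in>node_pairs n. (edge_prob A i j)\<^sup>2)"
    unfolding expectation_pair_pmf_mult[OF finite_set_pmf_graph_model finite_set_pmf_graph_model]
    by (simp add: edge_prob_def power2_eq_square case_prod_unfold)
  finally show ?thesis
    by (subst sum_node_pairs) (auto simp: Ov_def edge_prob_sym edge_prob_diag)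
qed

text \<open>Three distinct vertices span three different unordered pairs, whose entries are
  independent. If two indices coincide, a diagonal entry makes both sides 0.\<close>

lemma expectation_ordered_triangle:
  assumes indep: "prob_space.indep_vars (measure_pmf A) (\<lambda>_. borel) (\<lambda>(i, j) M. M i j) (node_pairs n)"
    and ijk: "i \<in> {1..n}" "j \<in> {1..n}" "k \<in> {1..n}"
  shows "measure_pmf.expectation A (\<lambda>M. M i j * M j k * M k i)
    = edge_prob A i j * edge_prob A j k * edge_prob A k i"
proof (cases "i \<noteq> j \<and> j \<noteq> k \<and> k \<noteq> i")
  case True
  \<comment> \<open>Independence concerns the entries above the diagonal only.\<close>
  define e where "e = (\<lambda>u v :: nat. (min u v, max u v))"
  define X where "X = (\<lambda>(u, v) (M :: nat \<Rightarrow> nat \<Rightarrow> real). M u v)"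
  have X: "M u v = X (e u v) M" if "M \<in> set_pmf A" for M u v
    using sym_if_mem[OF that] by (simp add: X_def e_def min_def max_def)
  have p: "edge_prob A u v = measure_pmf.expectation A (X (e u v))" for u v
    unfolding edge_prob_def by (intro integral_cong_AE) (auto simp: AE_measure_pmf_iff X)
  let ?K = "{e i j, e j k, e k i}"
  \<comment> \<open>Distinctness ensures that a product over the set \<open>?K\<close> really has
    three factors.\<close>
  have dist: "e i j \<noteq> e j k" "e j k \<noteq> e k i" "e i j \<noteq> e k i"
    using True by (auto simp: e_def min_def max_def split: if_splits)
  have "?K \<subseteq> node_pairs n"
    using True ijk by (auto simp: e_def node_pairs_def min_def max_def)
  then have "prob_space.indep_vars (measure_pmf A) (\<lambda>_. borel) X ?K"
    using prob_space.indep_vars_subset[OF prob_space_measure_pmf indep] unfolding X_def by blast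
  then have *: "measure_pmf.expectation A (\<lambda>M. \<Prod>z\<in>?K. X z M)
      = (\<Prod>z\<in>?K. measure_pmf.expectation A (X z))"
    by (intro prob_space.indep_vars_lebesgue_integral[OF prob_space_measure_pmf])
       (auto intro: integrable_graph_model)
  have "measure_pmf.expectation A (\<lambda>M. M i j * M j k * M k i)
      = measure_pmf.expectation A (\<lambda>M. \<Prod>z\<in>?K. X z M)"
    by (intro integral_cong_AE) (use dist in \<open>auto simp: AE_measure_pmf_iff X\<close>)
  also note *
  also have "(\<Prod>z\<in>?K. measure_pmf.expectation A (X z))
      = edge_prob A i j * edge_prob A j k * edge_prob A k i"
    using dist by (simp add: p mult_ac)
  finally show ?thesis .
next
  case False
  then have "measure_pmf.expectation A (\<lambda>M. M i j * M j k * M k i)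
      = measure_pmf.expectation A (\<lambda>_. 0)"
    by (intro integral_cong_AE) (auto simp: AE_measure_pmf_iff diag_if_mem)
  with False show ?thesis
    by (auto simp: edge_prob_diag)
qed

lemma expectation_triangles:
  assumes "prob_space.indep_vars (measure_pmf A) (\<lambda>_. borel) (\<lambda>(i, j) M. M i j) (node_pairs n)"
  shows "measure_pmf.expectation A (\<lambda>M. real (card (triangles n M)))
    = (\<Sum>(i, j, k)\<in>{1..n} \<times> {1..n} \<times> {1..n}.
        edge_prob A i j * edge_prob A j k * edge_prob A k i) / 6"
proof -
  let ?I = "{1..n} \<times> {1..n} \<times> {1..n}"
  have "measure_pmf.expectation A (\<lambda>M. real (card (triangles n M)))
      = measure_pmf.expectation A (\<lambda>M. (\<Sum>(i, j, k)\<in>?I. M i j * M j k * M k i) / 6)"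
    by (intro integral_cong_AE)
       (auto simp: AE_measure_pmf_iff card_triangles adjacency_matrix_if_mem)
  also have "\<dots> = (\<Sum>(i, j, k)\<in>?I. measure_pmf.expectation A (\<lambda>M. M i j * M j k * M k i)) / 6"
    by (simp add: case_prod_unfold integrable_graph_model)
  also have "\<dots> = (\<Sum>(i, j, k)\<in>?I. edge_prob A i j * edge_prob A j k * edge_prob A k i) / 6"
    using expectation_ordered_triangle[OF assms] by (intro arg_cong2[where f = divide] sum.cong) auto
  finally show ?thesis .
qed

end

theorem theorem1:
  fixes n :: nat and A :: "(nat \<Rightarrow> nat \<Rightarrow> real) pmf"
  assumes "edge_independent n A"
    and "Vol n A > 0"
  shows "measure_pmf.expectation A (\<lambda>M. real (card (triangles n M))) \<le> real n ^ 3 / 6 * Ov n A ^ 3"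
proof -
  have model: "graph_model n A"
    and indep: "prob_space.indep_vars (measure_pmf A) (\<lambda>_. borel) (\<lambda>(i, j) M. M i j) (node_pairs n)"
    using assms(1) by (auto simp: edge_independent_def)
  let ?I = "{1..n}" and ?p = "edge_prob A"
  define T where "T = (\<Sum>(i, j, k)\<in>?I \<times> ?I \<times> ?I. ?p i j * ?p j k * ?p k i)"
  define F where "F = (\<Sum>(i, j)\<in>?I \<times> ?I. (?p i j)\<^sup>2)"
  define W where "W = 2 * Vol n A"
  have W: "W > 0"
    using assms(2) by (simp add: W_def)
  have F0: "F \<ge> 0"
    unfolding F_def by (rule sum_nonneg) auto
  have TF: "T\<^sup>2 \<le> F ^ 3"
    unfolding T_def F_def by (rule trace_cube_le) (rule edge_prob_sym[OF model])
  \<comment> \<open>\<open>W\<close> is the sum of all edge probabilities; pairing it with the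
    constant 1 brings in the number of entries, the square of \<open>n\<close>.\<close>
  have "W\<^sup>2 = (\<Sum>z\<in>?I \<times> ?I. 1 * case_prod ?p z)\<^sup>2"
    by (simp add: W_def Vol_eq[OF model])
  also have "\<dots> \<le> (\<Sum>z\<in>?I \<times> ?I. 1\<^sup>2) * (\<Sum>z\<in>?I \<times> ?I. (case_prod ?p z)\<^sup>2)"
    by (rule Cauchy_Schwarz_ineq_sum)
  finally have WF: "W\<^sup>2 \<le> (real n)\<^sup>2 * F"
    by (simp add: F_def case_prod_unfold power2_eq_square)
  \<comment> \<open>Comparing squares avoids the half-integer powers of \<open>F\<close> that
    bounding \<open>T\<close> directly would produce.\<close>
  have "T\<^sup>2 * (W ^ 3)\<^sup>2 = T\<^sup>2 * (W\<^sup>2) ^ 3"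
    by (simp add: power_mult[symmetric])
  also have "\<dots> \<le> F ^ 3 * ((real n)\<^sup>2 * F) ^ 3"
    using TF WF F0 by (intro mult_mono power_mono) auto
  also have "\<dots> = ((real n * F) ^ 3)\<^sup>2"
    by (simp add: algebra_simps power_mult_distrib power_mult[symmetric] power_add[symmetric])
  finally have "(T * W ^ 3)\<^sup>2 \<le> ((real n * F) ^ 3)\<^sup>2"
    by (simp add: power_mult_distrib)
  then have "T * W ^ 3 \<le> (real n * F) ^ 3"
    by (rule power2_le_imp_le) (use F0 in simp)
  then have "T \<le> (real n * F) ^ 3 / W ^ 3"
    using W by (simp add: pos_le_divide_eq)
  \<comment> \<open>By \<open>Ov_eq\<close>, the overlap is \<open>F / W\<close>.\<close>
  also have "\<dots> = real n ^ 3 * Ov n A ^ 3"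
    by (simp add: Ov_eq[OF model] F_def W_def power_mult_distrib power_divide)
  finally show ?thesis
    by (simp add: expectation_triangles[OF model indep] T_def)
qed

end
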